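(* Let $X$ be a complex Banach space, let $m \geq 1$ be an integer, and let $\varphi : X \to X$ be a holomorphic mapping. Then the composition operator $C_\varphi : \mathcal{P}(^m X) \to \mathcal{P}(^m X)$, $C_\varphi(p) = p \circ \varphi$, is well defined (that is, $p \circ \varphi \in \mathcal{P}(^m X)$ for every $p \in \mathcal{P}(^m X)$) if and only if $\varphi$ is linear.
   Context: For complex Banach spaces $X, Y$, a mapping $p : X \to Y$ is an $m$-homogeneous polynomial if there is a continuous $m$-linear operator $L : X \times \cdots \times X \to Y$ with $p(x) = L(x, \ldots, x)$ for every $x \in X$. The vector space of all $m$-homogeneous polynomials $X \to Y$ is denoted $\mathcal{P}(^m X, Y)$, and $\mathcal{P}(^m X) := \mathcal{P}(^m X, \mathbb{C})$. A function $f : X \to Y$ is holomorphic if there is a (unique) sequence $(p_k)_{k \geq 0}$, where $p_k : X \to Y$ is a $k$-homogeneous polynomial, such that $f(x) = \sum_{k=0}^\infty p_k(x)$ uniformly on the compact subsets of $X$. *)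

theory Defs
  imports "HOL-Analysis.Analysis"
begin

text \<open>
  Complex Banach spaces. The complex scalar multiplication extends the real one, so that the
  library's \<^class>\<open>real_normed_vector\<close> and \<^class>\<open>banach\<close> (norm, topology, completeness) are reused.
\<close>

class scaleC = scaleR +
  fixes scaleC :: "complex \<Rightarrow> 'a \<Rightarrow> 'a"  (infixr \<open>*\<^sub>C\<close> 75)
  assumes scaleR_scaleC: "r *\<^sub>R x = complex_of_real r *\<^sub>C x"

class complex_vector = scaleC + real_vector +
  assumes scaleC_add_right: "a *\<^sub>C (x + y) = a *\<^sub>C x + a *\<^sub>C y"
    and scaleC_add_left: "(a + b) *\<^sub>C x = a *\<^sub>C x + b *\<^sub>C x"
    and scaleC_scaleC: "a *\<^sub>C b *\<^sub>C x = (a * b) *\<^sub>C x"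
    and scaleC_one: "1 *\<^sub>C x = x"

class complex_normed_vector = complex_vector + real_normed_vector +
  assumes norm_scaleC: "norm (a *\<^sub>C x) = cmod a * norm x"

class complex_banach = complex_normed_vector + banach

instantiation complex :: complex_banach
begin

definition scaleC_complex :: "complex \<Rightarrow> complex \<Rightarrow> complex"
  where "scaleC_complex a x = a * x"

instance
  by standard
    (simp_all add: scaleC_complex_def scaleR_conv_of_real algebra_simps norm_mult)

end

lemma vector_space_scaleC: "vector_space (scaleC :: complex \<Rightarrow> 'a::complex_vector \<Rightarrow> 'a)"
  by standard (simp_all add: scaleC_add_right scaleC_add_left scaleC_scaleC scaleC_one)

abbreviation clinear :: "('a::complex_vector \<Rightarrow> 'b::complex_vector) \<Rightarrow> bool"
  where "clinear \<equiv> Vector_Spaces.linear scaleC scaleC"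

text \<open>
  Points of the \<open>m\<close>-fold product of \<open>X\<close> are the extensional functions on \<open>{..<m}\<close>, which are the
  points of the product topology over the index set \<open>{..<m}\<close>. For \<open>m = 0\<close> there is exactly
  one such tuple, so \<open>0\<close>-homogeneous polynomials are the constant functions.
\<close>

definition multilinear :: "nat \<Rightarrow> ((nat \<Rightarrow> 'a::complex_vector) \<Rightarrow> 'b::complex_vector) \<Rightarrow> bool"
  where "multilinear m L \<longleftrightarrow>
    (\<forall>x \<in> {..<m} \<rightarrow>\<^sub>E UNIV. \<forall>i<m. clinear (\<lambda>y. L (x(i := y))))"

definition continuous_multilinear ::
    "nat \<Rightarrow> ((nat \<Rightarrow> 'a::complex_normed_vector) \<Rightarrow> 'b::complex_normed_vector) \<Rightarrow> bool"
  where "continuous_multilinear m L \<longleftrightarrow>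
    multilinear m L \<and>
    continuous_map (product_topology (\<lambda>_. euclidean) {..<m}) euclidean L"

definition hom_polynomials ::
    "nat \<Rightarrow> ('a::complex_normed_vector \<Rightarrow> 'b::complex_normed_vector) set"
  where "hom_polynomials m =
    {p. \<exists>L. continuous_multilinear m L \<and> (\<forall>x. p x = L (\<lambda>i\<in>{..<m}. x))}"

text \<open>
  Uniqueness of the sequence \<open>p\<close> is a consequence, not part of the requirement. The library's
  \<open>holomorphic_on\<close> only covers functions of one complex variable.
\<close>

definition holomorphic_map :: "('a::complex_banach \<Rightarrow> 'b::complex_banach) \<Rightarrow> bool"
  where "holomorphic_map f \<longleftrightarrow>
    (\<exists>p. (\<forall>k. p k \<in> hom_polynomials k) \<and>
      (\<forall>K. compact K \<longrightarrow> uniform_limit K (\<lambda>n x. \<Sum>k<n. p k x) f sequentially))"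

definition composition_operator :: "('a \<Rightarrow> 'a) \<Rightarrow> ('a \<Rightarrow> complex) \<Rightarrow> 'a \<Rightarrow> complex"
  where "composition_operator \<phi> p = p \<circ> \<phi>"

end

theory Submission
  imports Defs "HOL-Complex_Analysis.Complex_Analysis"
begin

text \<open>
  Continuous linear functionals turn the claim into a statement about entire functions of one
  variable. For such a functional \<open>f\<close> the power \<open>f\<^sup>m\<close> is an \<open>m\<close>-homogeneous polynomial; if
  \<open>f\<^sup>m \<circ> \<phi>\<close> is one as well, then \<open>f (\<phi> (c x))\<^sup>m = c\<^sup>m f (\<phi> x)\<^sup>m\<close>, so that
  \<open>\<bar>f (\<phi> (c x))\<bar> = \<bar>c\<bar> \<bar>f (\<phi> x)\<bar>\<close>. Taking absolute values removes the unknown \<open>m\<close>-th root of unity.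
  With the expansion \<open>\<phi> = \<Sum>k. p\<^sub>k\<close> into homogeneous polynomials, \<open>c \<mapsto> f (\<phi> (c x))\<close> is the entire
  function \<open>\<Sum>k. f (p\<^sub>k x) c\<^sup>k\<close>, and it is bounded by a multiple of \<open>\<bar>c\<bar>\<close>. By Liouville's theorem
  only the term \<open>k = 1\<close> survives, hence \<open>f (\<phi> x) = f (p\<^sub>1 x)\<close>. Functionals separate points by the
  Hahn--Banach theorem, and so \<open>\<phi> = p\<^sub>1\<close> is linear (\<open>holomorphic_map_is_linear_term\<close>).

  For the converse, the only gap between a linear \<open>\<phi>\<close> and the pull-back of multilinear forms along
  \<open>\<phi>\<close> is continuity. A linear \<open>\<phi>\<close> also satisfies \<open>\<bar>f (\<phi> (c x))\<bar> = \<bar>c\<bar> \<bar>f (\<phi> x)\<bar>\<close>, so the same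
  lemma applies: \<open>\<phi>\<close> equals \<open>p\<^sub>1\<close>, which is continuous.

  The Hahn--Banach theorem is proved through minimal sublinear functionals: by Zorn's lemma there is
  a minimal one below any sublinear functional, and minimal sublinear functionals are linear.
\<close>

section \<open>Norming functionals\<close>

definition sublinear :: "('a::real_vector \<Rightarrow> real) \<Rightarrow> bool" where
  "sublinear p \<longleftrightarrow> (\<forall>x y. p (x + y) \<le> p x + p y) \<and> (\<forall>t\<ge>0. \<forall>x. p (t *\<^sub>R x) = t * p x)"

lemma sublinear_add: "sublinear p \<Longrightarrow> p (x + y) \<le> p x + p y"
  and sublinear_scaleR: "sublinear p \<Longrightarrow> 0 \<le> t \<Longrightarrow> p (t *\<^sub>R x) = t * p x"
  unfolding sublinear_def by auto

lemma sublinear_zero: "sublinear p \<Longrightarrow> p 0 = 0"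
  using sublinear_scaleR[of p 0 0] by simp

lemma sublinear_minus: "sublinear p \<Longrightarrow> - p (- x) \<le> p x"
  using sublinear_add[of p x "- x"] sublinear_zero[of p] by simp

lemma sublinearI:
  assumes add: "\<And>x y. p (x + y) \<le> p x + p y"
    and scale: "\<And>t x. 0 < t \<Longrightarrow> p (t *\<^sub>R x) \<le> t * p x"
    and zero: "p 0 = 0"
  shows "sublinear p"
proof -
  have "p (t *\<^sub>R x) = t * p x" if "0 < t" for t x
  proof (rule antisym)
    show "t * p x \<le> p (t *\<^sub>R x)"
      using that scale[of "inverse t" "t *\<^sub>R x"] by (simp add: field_simps)
  qed (use scale that in blast)
  then show ?thesis
    unfolding sublinear_def using add zero by (auto simp: order_le_less)
qed

text \<open>
  For sublinear \<open>p\<close>, this is the largest sublinear functional below \<open>p\<close> whose value at \<open>- y\<close> is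
  at most \<open>- p y\<close>; no sublinear functional below \<open>p\<close> is smaller at \<open>- y\<close>. The construction is used
  twice: with \<open>p\<close> the norm it forces the value of a functional at \<open>y\<close>, and with \<open>p\<close> minimal it
  proves additivity.
\<close>

definition tilt :: "('a::real_vector \<Rightarrow> real) \<Rightarrow> 'a \<Rightarrow> 'a \<Rightarrow> real" where
  "tilt p y x = (INF t\<in>{0..}. p (x + t *\<^sub>R y) - t * p y)"

lemma tilt_bdd_below:
  assumes "sublinear p"
  shows "bdd_below ((\<lambda>t. p (x + t *\<^sub>R y) - t * p y) ` {0..})"
proof (rule bdd_belowI2)
  fix t :: real
  assume "t \<in> {0..}"
  then show "- p (- x) \<le> p (x + t *\<^sub>R y) - t * p y"
    using sublinear_add[OF assms, of "x + t *\<^sub>R y" "- x"] sublinear_scaleR[OF assms, of t y]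
    by simp
qed

lemma tilt_le:
  assumes "sublinear p" "0 \<le> t"
  shows "tilt p y x \<le> p (x + t *\<^sub>R y) - t * p y"
  unfolding tilt_def by (rule cINF_lower[OF tilt_bdd_below[OF assms(1)]]) (use assms in simp)

lemma tilt_greatest:
  assumes "\<And>t. 0 \<le> t \<Longrightarrow> b \<le> p (x + t *\<^sub>R y) - t * p y"
  shows "b \<le> tilt p y x"
  unfolding tilt_def by (rule cINF_greatest) (use assms in auto)

lemma tilt_le_self: "sublinear p \<Longrightarrow> tilt p y \<le> p"
  using tilt_le[of p 0] by (auto simp: le_fun_def)

lemma sublinear_tilt:
  assumes p: "sublinear p"
  shows "sublinear (tilt p y)"
proof (rule sublinearI)
  fix x x'
  have "tilt p y (x + x') - (p (x' + s *\<^sub>R y) - s * p y) \<le> p (x + t *\<^sub>R y) - t * p y"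
    if "0 \<le> s" "0 \<le> t" for s t
    using tilt_le[OF p, of "t + s" y "x + x'"] that
      sublinear_add[OF p, of "x + t *\<^sub>R y" "x' + s *\<^sub>R y"]
    by (simp add: algebra_simps)
  then have "tilt p y (x + x') - (p (x' + s *\<^sub>R y) - s * p y) \<le> tilt p y x" if "0 \<le> s" for s
    using that by (intro tilt_greatest)
  then have "tilt p y (x + x') - tilt p y x \<le> tilt p y x'"
    by (intro tilt_greatest) (simp add: algebra_simps)
  then show "tilt p y (x + x') \<le> tilt p y x + tilt p y x'"
    by simp
next
  fix c :: real and x
  assume c: "0 < c"
  have "tilt p y (c *\<^sub>R x) / c \<le> p (x + t *\<^sub>R y) - t * p y" if "0 \<le> t" for t
    using tilt_le[OF p, of "c * t" y "c *\<^sub>R x"] that c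
      sublinear_scaleR[OF p, of c "x + t *\<^sub>R y"]
    by (simp add: field_simps scaleR_add_right)
  then show "tilt p y (c *\<^sub>R x) \<le> c * tilt p y x"
    using tilt_greatest[of "tilt p y (c *\<^sub>R x) / c" p x y] c by (simp add: field_simps)
next
  show "tilt p y 0 = 0"
    by (simp add: tilt_def sublinear_scaleR[OF p])
qed

text \<open>
  The chain condition makes subadditivity survive the pointwise infimum: two members of the chain
  that nearly attain the infimum at \<open>x\<close> and at \<open>y\<close> can be replaced by the smaller of the two. The
  common bound \<open>q\<close> keeps the infimum finite, since \<open>p x \<ge> - p (- x) \<ge> - q (- x)\<close>.
\<close>

lemma sublinear_INF_chain:
  assumes ne: "C \<noteq> {}" and sub: "\<And>p. p \<in> C \<Longrightarrow> sublinear p"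
    and le: "\<And>p. p \<in> C \<Longrightarrow> p \<le> q"
    and chain: "\<And>p p'. p \<in> C \<Longrightarrow> p' \<in> C \<Longrightarrow> p \<le> p' \<or> p' \<le> p"
  shows "sublinear (\<lambda>x. INF p\<in>C. p x)" "\<And>p. p \<in> C \<Longrightarrow> (\<lambda>x. INF p\<in>C. p x) \<le> p"
proof -
  let ?u = "\<lambda>x. INF p\<in>C. p x"
  have bdd: "bdd_below ((\<lambda>p. p x) ` C)" for x
  proof (rule bdd_belowI2)
    fix p assume "p \<in> C"
    then show "- q (- x) \<le> p x"
      using sublinear_minus[OF sub, of p x] le[of p] by (auto simp: le_fun_def dest: spec[of _ "- x"])
  qed
  have lower: "?u x \<le> p x" if "p \<in> C" for p x
    using bdd that by (rule cINF_lower)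
  have greatest: "b \<le> ?u x" if "\<And>p. p \<in> C \<Longrightarrow> b \<le> p x" for b x
    using ne that by (rule cINF_greatest)
  show "?u \<le> p" if "p \<in> C" for p
    using lower[OF that] by (simp add: le_fun_def)
  show "sublinear ?u"
  proof (rule sublinearI)
    fix x y
    have "?u (x + y) - p' y \<le> p x" if C: "p \<in> C" "p' \<in> C" for p p'
    proof -
      obtain r where "r \<in> C" "r \<le> p" "r \<le> p'"
        using chain[OF C] C by auto
      then show ?thesis
        using lower[of r "x + y"] sublinear_add[OF sub, of r x y]
          le_funD[OF \<open>r \<le> p\<close>, of x] le_funD[OF \<open>r \<le> p'\<close>, of y]
        by linarith
    qed
    then have "?u (x + y) - p' y \<le> ?u x" if "p' \<in> C" for p'
      using that by (intro greatest)
    then have "?u (x + y) - ?u x \<le> ?u y"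
      by (intro greatest) (simp add: algebra_simps)
    then show "?u (x + y) \<le> ?u x + ?u y"
      by simp
  next
    fix t :: real and x
    assume t: "0 < t"
    have "?u (t *\<^sub>R x) / t \<le> p x" if "p \<in> C" for p
      using lower[OF that, of "t *\<^sub>R x"] sublinear_scaleR[OF sub[OF that], of t x] t
      by (simp add: field_simps)
    then have "?u (t *\<^sub>R x) / t \<le> ?u x"
      by (rule greatest)
    then show "?u (t *\<^sub>R x) \<le> t * ?u x"
      using t by (simp add: field_simps)
  next
    have "(\<lambda>p. p 0) ` C = {0}"
      using ne sublinear_zero[OF sub] by force
    then show "?u 0 = 0"
      by simp
  qed
qed

lemma minimal_sublinear_exists:
  assumes q: "sublinear q"
  obtains p where "sublinear p" "p \<le> q" "\<And>r. sublinear r \<Longrightarrow> r \<le> p \<Longrightarrow> r = p"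
proof -
  let ?A = "{p. sublinear p \<and> p \<le> q}"
  let ?R = "relation_of (\<lambda>p r. r \<le> p) ?A"
  have "\<exists>m\<in>?A. \<forall>a\<in>?A. a \<le> m \<longrightarrow> a = m"
  proof (rule predicate_Zorn)
    show "partial_order_on ?A ?R"
      by (rule partial_order_on_relation_ofI) auto
    fix C assume "C \<in> Chains ?R"
    then have C: "\<And>p. p \<in> C \<Longrightarrow> p \<in> ?A"
      and chain: "\<And>p p'. p \<in> C \<Longrightarrow> p' \<in> C \<Longrightarrow> p \<le> p' \<or> p' \<le> p"
      by (auto simp: Chains_def relation_of_def)
    show "\<exists>u\<in>?A. \<forall>a\<in>C. u \<le> a"
    proof (cases "C = {}")
      case True
      then show ?thesis using q by auto
    next
      case False
      then obtain p where "p \<in> C" by blast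
      let ?u = "\<lambda>x. INF p\<in>C. p x"
      have "sublinear ?u" and le: "\<And>p. p \<in> C \<Longrightarrow> ?u \<le> p"
        using sublinear_INF_chain[of C q] False C chain by auto
      moreover have "?u \<le> q"
        using le[OF \<open>p \<in> C\<close>] C[OF \<open>p \<in> C\<close>] by auto
      ultimately show ?thesis by blast
    qed
  qed
  then obtain p where p: "sublinear p" "p \<le> q" and
    min: "\<And>r. sublinear r \<Longrightarrow> r \<le> q \<Longrightarrow> r \<le> p \<Longrightarrow> r = p"
    by auto
  have "r = p" if "sublinear r" "r \<le> p" for r
    using min[of r] that p(2) by (meson order_trans)
  with p show ?thesis by (rule that)
qed

text \<open>
  Tilting cannot change a minimal functional. The defining infimum, evaluated at the parameter \<open>1\<close>,
  then reads \<open>p x \<le> p (x + y) - p y\<close>, which is the missing half of additivity.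
\<close>

lemma minimal_sublinear_imp_linear:
  assumes p: "sublinear p" and min: "\<And>r. sublinear r \<Longrightarrow> r \<le> p \<Longrightarrow> r = p"
  shows "linear p"
proof -
  have tilt: "tilt p y = p" for y
    using min sublinear_tilt[OF p] tilt_le_self[OF p] by blast
  have add: "p (x + y) = p x + p y" for x y
    using tilt_le[OF p, of 1 y x] sublinear_add[OF p, of x y] unfolding tilt by simp
  have minus: "p (- x) = - p x" for x
    using add[of x "- x"] sublinear_zero[OF p] by simp
  have "p (t *\<^sub>R x) = t * p x" for t x
  proof (cases "0 \<le> t")
    case False
    then show ?thesis
      using sublinear_scaleR[OF p, of "- t" x] minus[of "t *\<^sub>R x"] by simp
  qed (rule sublinear_scaleR[OF p])
  with add show ?thesis
    by (intro linearI) auto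
qed

text \<open>
  A minimal sublinear functional below the norm tilted at \<open>x0\<close> takes at \<open>- x0\<close> a value of at most
  \<open>- norm x0\<close>; linearity turns this into the value \<open>norm x0\<close> at \<open>x0\<close>.
\<close>

lemma real_norming_functional:
  fixes x0 :: "'a::real_normed_vector"
  obtains p :: "'a \<Rightarrow> real" where "linear p" "\<And>x. \<bar>p x\<bar> \<le> norm x" "p x0 = norm x0"
proof -
  have norm: "sublinear (norm :: 'a \<Rightarrow> real)"
    by (simp add: sublinear_def norm_triangle_ineq)
  obtain p where p: "sublinear p" "p \<le> tilt norm x0" "\<And>r. sublinear r \<Longrightarrow> r \<le> p \<Longrightarrow> r = p"
    using minimal_sublinear_exists[OF sublinear_tilt[OF norm]] by blast
  have lin: "linear p"
    using minimal_sublinear_imp_linear p(1,3) by blast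
  have le: "p x \<le> norm x" for x
    using p(2) tilt_le_self[OF norm, of x0] by (meson le_funD order_trans)
  have "\<bar>p x\<bar> \<le> norm x" for x
    using le[of x] le[of "- x"] linear_neg[OF lin, of x] by simp
  moreover have "p (- x0) \<le> - norm x0"
    using p(2) tilt_le[OF norm, of 1 x0 "- x0"] by (auto simp: le_fun_def dest!: spec[of _ "- x0"])
  then have "p x0 = norm x0"
    using le[of x0] linear_neg[OF lin, of x0] by simp
  ultimately show ?thesis
    using lin that by blast
qed

lemma clinear_iff:
  "clinear f \<longleftrightarrow> (\<forall>x y. f (x + y) = f x + f y) \<and> (\<forall>c x. f (c *\<^sub>C x) = c *\<^sub>C f x)"
  by (simp add: Vector_Spaces.linear_iff vector_space_scaleC)

text \<open>
  A complex linear functional is determined by its real part \<open>p\<close>, as \<open>x \<mapsto> p x - \<i> p (\<i> x)\<close>; this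
  formula makes any bounded real linear \<open>p\<close> the real part of a bounded complex linear functional.
\<close>

lemma continuous_functional_nonzero:
  fixes x0 :: "'a::complex_normed_vector"
  assumes "x0 \<noteq> 0"
  obtains f :: "'a \<Rightarrow> complex" where "clinear f" "continuous_on UNIV f" "f x0 \<noteq> 0"
proof -
  obtain p :: "'a \<Rightarrow> real" where
    lin: "linear p" and le: "\<And>x. \<bar>p x\<bar> \<le> norm x" and x0: "p x0 = norm x0"
    using real_norming_functional by blast
  define f where "f x = Complex (p x) (- p (\<i> *\<^sub>C x))" for x
  have add: "f (x + y) = f x + f y" for x y
    by (simp add: f_def complex_eq_iff scaleC_add_right linear_add[OF lin])
  have scale: "f (c *\<^sub>C x) = c * f x" for c x
  proof -
    have split: "d *\<^sub>C x = Re d *\<^sub>R x + Im d *\<^sub>R (\<i> *\<^sub>C x)" for d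
    proof -
      have "d = complex_of_real (Re d) + complex_of_real (Im d) * \<i>"
        by (simp add: complex_eq_iff)
      then have "d *\<^sub>C x = (complex_of_real (Re d) + complex_of_real (Im d) * \<i>) *\<^sub>C x"
        by simp
      then show ?thesis
        by (simp only: scaleC_add_left scaleC_scaleC[symmetric] scaleR_scaleC[symmetric])
    qed
    have p_split: "p (d *\<^sub>C x) = Re d * p x + Im d * p (\<i> *\<^sub>C x)" for d
      by (subst split) (simp add: linear_add[OF lin] linear_scale[OF lin])
    show ?thesis
      using p_split[of c] p_split[of "\<i> * c"] by (simp add: f_def complex_eq_iff scaleC_scaleC)
  qed
  have "f (r *\<^sub>R x) = r *\<^sub>R f x" for r x
    by (simp add: scaleR_scaleC scale scaleC_complex_def)
  moreover have "norm (f x) \<le> norm x * 2" for x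
    using le[of x] le[of "\<i> *\<^sub>C x"] cmod_le[of "f x"] by (simp add: f_def norm_scaleC)
  ultimately have "bounded_linear f"
    using add by (intro bounded_linear_intro)
  then have "continuous_on UNIV f"
    by (rule linear_continuous_on)
  moreover have "clinear f"
    using add scale by (simp add: clinear_iff scaleC_complex_def)
  moreover have "f x0 \<noteq> 0"
    using x0 assms by (simp add: f_def complex_eq_iff)
  ultimately show ?thesis
    using that by blast
qed

lemma eq_if_functionals_eq:
  fixes x y :: "'a::complex_normed_vector"
  assumes "\<And>f :: 'a \<Rightarrow> complex. clinear f \<Longrightarrow> continuous_on UNIV f \<Longrightarrow> f x = f y"
  shows "x = y"
proof (rule ccontr)
  assume "x \<noteq> y"
  then obtain f :: "'a \<Rightarrow> complex" where f: "clinear f" "continuous_on UNIV f" "f (x - y) \<noteq> 0"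
    using continuous_functional_nonzero[of "x - y"] by auto
  have "f x = f (x - y) + f y"
    using f(1) by (metis clinear_iff diff_add_cancel)
  then show False
    using assms[OF f(1,2)] f(3) by simp
qed

section \<open>Homogeneous polynomials\<close>

text \<open>
  Moving the scalar through the arguments of the multilinear map, one coordinate at a time,
  yields one factor for each of the \<open>k\<close> coordinates.
\<close>

lemma hom_polynomials_scaleC:
  assumes "p \<in> hom_polynomials k"
  shows "p (c *\<^sub>C x) = c ^ k *\<^sub>C p x"
proof -
  obtain L where L: "multilinear k L" "\<And>x. p x = L (\<lambda>i\<in>{..<k}. x)"
    using assms by (auto simp: hom_polynomials_def continuous_multilinear_def)
  define t where "t j = (\<lambda>i\<in>{..<k}. if i < j then c *\<^sub>C x else x)" for j
  have "L (t j) = c ^ j *\<^sub>C L (t 0)" if "j \<le> k" for j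
    using that
  proof (induction j)
    case 0
    then show ?case by (simp add: scaleC_one)
  next
    case (Suc j)
    have upd: "t (Suc j) = (t j)(j := c *\<^sub>C x)" "(t j)(j := x) = t j"
      using Suc.prems by (auto simp: t_def fun_eq_iff restrict_def)
    have "clinear (\<lambda>y. L ((t j)(j := y)))"
      using L(1) Suc.prems unfolding multilinear_def by (auto simp: t_def)
    then have "L (t (Suc j)) = c *\<^sub>C L (t j)"
      using upd by (simp add: clinear_iff)
    then show ?case
      using Suc by (simp add: scaleC_scaleC)
  qed
  from this[of k] show ?thesis
    by (simp add: L(2) t_def restrict_def cong: if_cong)
qed

lemma continuous_map_coordinate:
  assumes "continuous_on UNIV T" "i \<in> I"
  shows "continuous_map (product_topology (\<lambda>_. euclidean) I) euclidean (\<lambda>t. T (t i))"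
  using continuous_map_compose[OF continuous_map_product_projection[OF assms(2)], of "\<lambda>_. euclidean" euclidean T]
    assms(1) by (simp add: o_def)

lemma hom_polynomials_1_iff:
  "p \<in> hom_polynomials 1 \<longleftrightarrow> clinear p \<and> continuous_on UNIV p"
proof
  assume "p \<in> hom_polynomials 1"
  then obtain L where L: "multilinear 1 L"
      "continuous_map (product_topology (\<lambda>_. euclidean) {..<1}) euclidean L"
    and p: "p = (\<lambda>x. L (\<lambda>i\<in>{..<1}. x))"
    by (auto simp: hom_polynomials_def continuous_multilinear_def fun_eq_iff)
  have eq: "(\<lambda>i\<in>{..<1::nat}. x) = (\<lambda>i\<in>{..<1}. 0)(0 := x)" for x :: 'a
    by (auto simp: fun_eq_iff)
  have "p x = L ((\<lambda>i\<in>{..<1}. 0)(0 := x))" for x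
    by (simp only: p eq[of x])
  then have "p = (\<lambda>x. L ((\<lambda>i\<in>{..<1}. 0)(0 := x)))" ..
  then have "clinear p"
    using L(1) unfolding multilinear_def by auto
  moreover have "continuous_map euclidean (product_topology (\<lambda>_. euclidean) {..<1})
      (\<lambda>x. \<lambda>i\<in>{..<1::nat}. x :: 'a)"
    by (auto simp: continuous_map_componentwise)
  from continuous_map_compose[OF this L(2)] have "continuous_on UNIV p"
    by (simp add: p o_def)
  ultimately show "clinear p \<and> continuous_on UNIV p" ..
next
  assume p: "clinear p \<and> continuous_on UNIV p"
  have "continuous_map (product_topology (\<lambda>_. euclidean) {..<1::nat}) euclidean (\<lambda>t. p (t 0))"
    using p by (intro continuous_map_coordinate) auto
  moreover have "multilinear 1 (\<lambda>t. p (t 0))"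
    using p unfolding multilinear_def by simp
  moreover have "p x = p ((\<lambda>i\<in>{..<1::nat}. x) 0)" for x
    by simp
  ultimately show "p \<in> hom_polynomials 1"
    unfolding hom_polynomials_def continuous_multilinear_def by blast
qed

lemma power_functional_in_hom_polynomials:
  fixes f :: "'a::complex_normed_vector \<Rightarrow> complex"
  assumes "clinear f" "continuous_on UNIV f"
  shows "(\<lambda>x. f x ^ m) \<in> hom_polynomials m"
proof -
  let ?L = "\<lambda>t. \<Prod>i<m. f (t i)"
  have "multilinear m ?L"
    unfolding multilinear_def
  proof (intro ballI allI impI)
    fix t i assume i: "i < m"
    have "(\<Prod>j<m. f ((t(i := y)) j)) = f y * (\<Prod>j\<in>{..<m} - {i}. f (t j))" for y
      by (subst prod.remove[of _ i]) (use i in auto)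
    then show "clinear (\<lambda>y. \<Prod>j<m. f ((t(i := y)) j))"
      using assms(1) by (simp add: clinear_iff scaleC_complex_def algebra_simps)
  qed
  moreover have "continuous_map (product_topology (\<lambda>_. euclidean) {..<m}) euclidean (\<lambda>t. f (t i))"
    if "i < m" for i
    using assms(2) that by (intro continuous_map_coordinate) auto
  then have "continuous_map (product_topology (\<lambda>_. euclidean) {..<m}) euclidean ?L"
    unfolding continuous_map_atin by (auto intro!: tendsto_prod)
  ultimately show ?thesis
    by (auto simp: hom_polynomials_def continuous_multilinear_def intro!: exI[of _ ?L])
qed

lemma hom_polynomials_compose_linear:
  assumes p: "p \<in> hom_polynomials m" and T: "clinear T" "continuous_on UNIV T"
  shows "p \<circ> T \<in> hom_polynomials m"
proof -
  obtain L where L: "multilinear m L"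
      "continuous_map (product_topology (\<lambda>_. euclidean) {..<m}) euclidean L"
    and pL: "\<And>x. p x = L (\<lambda>i\<in>{..<m}. x)"
    using p by (auto simp: hom_polynomials_def continuous_multilinear_def)
  let ?T = "\<lambda>t. \<lambda>i\<in>{..<m}. T (t i)"
  have "multilinear m (\<lambda>t. L (?T t))"
    unfolding multilinear_def
  proof (intro ballI allI impI)
    fix t i assume i: "i < m"
    have "?T (t(i := y)) = (?T t)(i := T y)" for y
      using i by (auto simp: fun_eq_iff)
    moreover have "clinear (\<lambda>y. L ((?T t)(i := y)))"
      using L(1) i unfolding multilinear_def by auto
    ultimately show "clinear (\<lambda>y. L (?T (t(i := y))))"
      using T(1) by (simp add: clinear_iff)
  qed
  moreover have "continuous_map (product_topology (\<lambda>_. euclidean) {..<m}) euclidean (\<lambda>t. T (t i))"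
    if "i < m" for i
    using T(2) that by (intro continuous_map_coordinate) auto
  then have "continuous_map (product_topology (\<lambda>_. euclidean) {..<m})
      (product_topology (\<lambda>_. euclidean) {..<m}) ?T"
    by (auto simp: continuous_map_componentwise)
  from continuous_map_compose[OF this L(2)]
  have "continuous_map (product_topology (\<lambda>_. euclidean) {..<m}) euclidean (\<lambda>t. L (?T t))"
    by (simp add: o_def)
  moreover have "(p \<circ> T) x = L (?T (\<lambda>i\<in>{..<m}. x))" for x
    by (simp add: pL cong: restrict_cong)
  ultimately show ?thesis
    by (auto simp: hom_polynomials_def continuous_multilinear_def intro!: exI[of _ "\<lambda>t. L (?T t)"])
qed

section \<open>Holomorphic maps of linear growth\<close>

text \<open>
  By Liouville's theorem an entire function of linear growth is a polynomial of degree at most one;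
  the bound at \<open>z = 0\<close> excludes the constant term.
\<close>

lemma power_series_linear_growth:
  fixes a :: "nat \<Rightarrow> complex"
  assumes sums: "\<And>z. (\<lambda>n. a n * z ^ n) sums G z"
    and growth: "\<And>z. cmod (G z) \<le> B * cmod z"
  shows "G z = a 1 * z"
proof -
  have G: "G = (\<lambda>z. \<Sum>n. a n * z ^ n)"
    using sums by (auto simp: sums_iff)
  have deriv: "(G has_field_derivative (\<Sum>n. diffs a n * z ^ n)) (at z)" for z
    unfolding G using sums by (intro termdiffs_strong_converges_everywhere) (auto simp: sums_iff)
  have "G holomorphic_on UNIV"
    using deriv by (auto simp: holomorphic_on_def field_differentiable_def intro: has_field_derivative_at_within)
  then have "G z = (\<Sum>k\<le>1. (deriv ^^ k) G 0 / fact k * z ^ k)"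
    using growth by (intro Liouville_polynomial[where A = 0 and B = B]) auto
  moreover have "G 0 = 0"
    using growth[of 0] by simp
  moreover have "deriv G 0 = a 1"
    using DERIV_imp_deriv[OF deriv[of 0]] by (simp add: diffs_def)
  ultimately show ?thesis
    by simp
qed

text \<open>
  Testing with functionals makes the restriction of \<open>\<phi>\<close> to each complex line through the origin an entire
  function of linear growth, whose expansion coefficients come from the homogeneous terms of \<open>\<phi>\<close>.
  The hypothesis is on absolute values only, because a composition with \<open>m\<close>-th powers determines
  \<open>f (\<phi> (c x))\<close> no better than up to an \<open>m\<close>-th root of unity.
\<close>

lemma holomorphic_map_is_linear_term:
  assumes \<phi>: "holomorphic_map \<phi>"
    and scale: "\<And>f c x. clinear f \<Longrightarrow> continuous_on UNIV f \<Longrightarrow>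
      cmod (f (\<phi> (c *\<^sub>C x))) = cmod c * cmod (f (\<phi> x))"
  shows "\<phi> \<in> hom_polynomials 1"
proof -
  obtain p where p: "\<And>k. p k \<in> hom_polynomials k"
    and lim: "\<And>K. compact K \<Longrightarrow> uniform_limit K (\<lambda>n x. \<Sum>k<n. p k x) \<phi> sequentially"
    using \<phi> by (auto simp: holomorphic_map_def)
  have "\<phi> x = p 1 x" for x
  proof (rule eq_if_functionals_eq)
    fix f :: "'b \<Rightarrow> complex"
    assume f: "clinear f" "continuous_on UNIV f"
    have f_sum: "f (sum g A) = (\<Sum>i\<in>A. f (g i))" for g :: "nat \<Rightarrow> 'b" and A
      using f(1) by (simp add: module_hom.sum linear_iff_module_hom)
    have "(\<lambda>k. f (p k x) * z ^ k) sums f (\<phi> (z *\<^sub>C x))" for z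
    proof -
      have "(\<lambda>n. \<Sum>k<n. p k (z *\<^sub>C x)) \<longlonglongrightarrow> \<phi> (z *\<^sub>C x)"
        using lim[of "{z *\<^sub>C x}"] by (auto intro: tendsto_uniform_limitI)
      then have "(\<lambda>n. f (\<Sum>k<n. p k (z *\<^sub>C x))) \<longlonglongrightarrow> f (\<phi> (z *\<^sub>C x))"
        by (intro continuous_on_tendsto_compose[OF f(2)]) auto
      moreover have "f (p k (z *\<^sub>C x)) = f (p k x) * z ^ k" for k
        using f(1) hom_polynomials_scaleC[OF p[of k]]
        by (simp add: clinear_iff scaleC_complex_def)
      ultimately show ?thesis
        by (simp add: f_sum sums_def)
    qed
    from power_series_linear_growth[OF this, of "cmod (f (\<phi> x))" 1]
    show "f (\<phi> x) = f (p 1 x)"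
      using scale[OF f] by (simp add: scaleC_one mult.commute)
  qed
  then show ?thesis
    using p[of 1] by (metis ext)
qed

section \<open>Composition operators\<close>

theorem proposition2p2:
  fixes \<phi> :: "'a::complex_banach \<Rightarrow> 'a" and m :: nat
  assumes "m \<ge> 1" and "holomorphic_map \<phi>"
  shows "(\<forall>p \<in> (hom_polynomials m :: ('a \<Rightarrow> complex) set).
            composition_operator \<phi> p \<in> hom_polynomials m) \<longleftrightarrow> clinear \<phi>"
proof
  assume C: "\<forall>p \<in> (hom_polynomials m :: ('a \<Rightarrow> complex) set).
    composition_operator \<phi> p \<in> hom_polynomials m"
  have "\<phi> \<in> hom_polynomials 1"
  proof (rule holomorphic_map_is_linear_term[OF assms(2)])
    fix f :: "'a \<Rightarrow> complex" and c x
    assume f: "clinear f" "continuous_on UNIV f"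
    have "(\<lambda>x. f (\<phi> x) ^ m) \<in> hom_polynomials m"
      using C power_functional_in_hom_polynomials[OF f, of m]
      by (force simp: composition_operator_def o_def)
    from hom_polynomials_scaleC[OF this, of c x]
    have "f (\<phi> (c *\<^sub>C x)) ^ m = (c * f (\<phi> x)) ^ m"
      by (simp add: scaleC_complex_def power_mult_distrib)
    then have "cmod (f (\<phi> (c *\<^sub>C x))) ^ m = (cmod c * cmod (f (\<phi> x))) ^ m"
      by (metis norm_mult norm_power)
    then show "cmod (f (\<phi> (c *\<^sub>C x))) = cmod c * cmod (f (\<phi> x))"
      by (rule power_eq_imp_eq_base) (use assms(1) in simp_all)
  qed
  then show "clinear \<phi>"
    unfolding hom_polynomials_1_iff by blast
next
  assume lin: "clinear \<phi>"
  have "\<phi> \<in> hom_polynomials 1"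
  proof (rule holomorphic_map_is_linear_term[OF assms(2)])
    fix f :: "'a \<Rightarrow> complex" and c x
    assume "clinear f"
    then show "cmod (f (\<phi> (c *\<^sub>C x))) = cmod c * cmod (f (\<phi> x))"
      using lin by (simp add: clinear_iff scaleC_complex_def norm_mult)
  qed
  then have "continuous_on UNIV \<phi>"
    unfolding hom_polynomials_1_iff by blast
  then show "\<forall>p \<in> (hom_polynomials m :: ('a \<Rightarrow> complex) set).
    composition_operator \<phi> p \<in> hom_polynomials m"
    using lin hom_polynomials_compose_linear by (auto simp: composition_operator_def)
qed

end
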